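(* Let $E$ and $S$ be Polish spaces endowed with filtrations $(\mathcal{B}_t(E))_{t\in I}$, $(\mathcal{B}_t(S))_{t\in I}$ of their Borel sigma-fields indexed by a same totally ordered set $I$, and assume that $(\mathcal{B}_t(S))_{t\in I}$ is a regular filtration. Let $\eta\in\mathcal{P}_E$, $\nu\in\mathcal{P}_S$, $\gamma\in\Pi(\eta,\nu)$, and let $\Theta$ be any kernel associated to $\gamma$. Then, for all $t\in I$, $\mathcal{G}_t(\gamma)$ is also the $\eta$-completion of the smallest sigma-field on $E$ such that for all $A\in\mathcal{B}_t(S)$ the map $\phi_A:x\in E\mapsto\Theta^x(A)\in\mathbb{R}$ is measurable. In particular the following assertions are equivalent: (i) $\gamma\in\Pi_c(\eta,\nu)$. (ii) For all $t\in I$ and $A\in\mathcal{B}_t(S)$, the map $\phi_A$ is $\mathcal{B}_t(E)^\eta$-measurable. (iii) For all $f\in\mathcal{L}^\infty(\eta)$ and all $t\in I$, $$E_\gamma\big[f\circ\pi\mid(\mathcal{B}_t(E)\otimes\mathcal{B}_t(S))^\gamma\big]=E_\eta\big[f\mid\mathcal{B}_t(E)^\eta\big]\circ\pi\quad\gamma\text{-a.s.}$$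
   Context: A filtration $(\mathcal{B}_t(E))_{t\in I}$ of $\mathcal{B}(E)$ is a family of sigma-fields with $\mathcal{B}_s(E)\subset\mathcal{B}_t(E)\subset\mathcal{B}(E)$ for $s\le t$ (similarly on $S$). $\mathcal{P}_Z$ is the set of Borel probabilities on a Polish space $Z$. For a sigma-field $\mathcal{G}\subset\mathcal{B}(E)$, $\mathcal{G}^\eta$ is its $\eta$-completion (generated by $\mathcal{G}$ and the $\eta$-negligible sets); similarly for $\gamma$ on $E\times S$. $\pi,\widetilde\pi$ are the projections of $E\times S$ onto $E$, $S$; $\Pi(\eta,\nu)=\{\gamma\in\mathcal{P}_{E\times S}:\pi_\star\gamma=\eta,\ \widetilde\pi_\star\gamma=\nu\}$. $\mathcal{L}^\infty(\eta)$: $\eta$-essentially bounded $\mathcal{B}(E)^\eta$-measurable real functions on $E$. Regular filtration: $(\mathcal{B}_t(S))_{t\in I}$ is regular if there is a family $(\rho_t)_{t\in I}$ of continuous maps $\rho_t:S\to S$ with $\mathcal{B}_t(S)=\rho_t^{-1}(\mathcal{B}(S))$ for all $t\in I$, $\rho_s\circ\rho_t=\rho_{\min(s,t)}$ for all $s,t\in I$, and $\rho_{t_f}=\mathrm{Id}_S$ for some $t_f\in I$. A kernel associated to $\gamma\in\Pi(\eta,\nu)$ is a map $\Theta:E\times\mathcal{B}(S)\to\mathbb{R}$ with $\Theta^x\in\mathcal{P}_S$ for all $x$, $x\mapsto\Theta^x(B)$ Borel for all $B$, and $\gamma(A\times B)=\int_A\Theta^x(B)\,d\eta(x)$ for all $A\in\mathcal{B}(E),B\in\mathcal{B}(S)$.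 For $t\in I$, $\mathcal{G}_t(\gamma)$ is by definition the $\eta$-completion of the smallest sigma-field on $E$ making $x\mapsto\Theta^x(C)$ measurable for every $C\in\mathcal{B}_t(S)$ with $\nu(\partial C)=0$. Causal transference plans: $\Pi_c(\eta,\nu)=\{\gamma\in\Pi(\eta,\nu):\mathcal{G}_t(\gamma)\subset\mathcal{B}_t(E)^\eta\ \text{for all }t\in I\}$. *)

theory Defs
  imports "HOL-Probability.Probability"
begin

text \<open>A sub-sigma-field of the Borel sets is a measure \<open>F\<close> with \<open>subalgebra borel F\<close>;
  only its sets matter, not the values of its measure.\<close>

definition borel_filtration ::
  "'i::linorder set \<Rightarrow> ('i \<Rightarrow> 'a::topological_space measure) \<Rightarrow> bool" where
  "borel_filtration I F \<longleftrightarrow>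
     (\<forall>t\<in>I. subalgebra borel (F t)) \<and>
     (\<forall>s\<in>I. \<forall>t\<in>I. s \<le> t \<longrightarrow> sets (F s) \<subseteq> sets (F t))"

definition regular_filtration ::
  "'i::linorder set \<Rightarrow> ('i \<Rightarrow> 's::topological_space measure) \<Rightarrow> bool" where
  "regular_filtration I F \<longleftrightarrow> borel_filtration I F \<and>
     (\<exists>\<rho>. (\<forall>t\<in>I. continuous_on UNIV (\<rho> t)) \<and>
          (\<forall>t\<in>I. sets (F t) = {\<rho> t -` B | B. B \<in> sets borel}) \<and>
          (\<forall>s\<in>I. \<forall>t\<in>I. \<rho> s \<circ> \<rho> t = \<rho> (min s t)) \<and>
          (\<exists>t\<in>I. \<rho> t = id))"

text \<open>The negligible sets added to \<open>G\<close> are those of \<open>\<mu>\<close> on its full sigma-field, not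
  only those of the restriction of \<open>\<mu>\<close> to \<open>G\<close>; hence \<^const>\<open>completion\<close> applied to
  that restriction would be too small.\<close>

definition completed_field :: "'a measure \<Rightarrow> 'a measure \<Rightarrow> 'a measure" where
  "completed_field \<mu> G =
     sigma (space \<mu>) (sets G \<union> {N. \<exists>N'\<in>null_sets \<mu>. N \<subseteq> N'})"

definition ess_bounded :: "'a measure \<Rightarrow> ('a \<Rightarrow> real) set" where
  "ess_bounded \<mu> =
     {f \<in> borel_measurable (completion \<mu>). \<exists>c. AE x in \<mu>. \<bar>f x\<bar> \<le> c}"

definition transference_plans ::
  "'e::topological_space measure \<Rightarrow> 's::topological_space measure \<Rightarrow> ('e \<times> 's) measure set" where
  "transference_plans \<eta> \<nu> =
     {\<gamma> \<in> space (prob_algebra borel). distr \<gamma> borel fst = \<eta> \<and> distr \<gamma> borel snd = \<nu>}"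

definition plan_kernel ::
  "'e::topological_space measure \<Rightarrow> ('e \<times> 's::topological_space) measure \<Rightarrow> ('e \<Rightarrow> 's measure) \<Rightarrow> bool"
  where
  "plan_kernel \<eta> \<gamma> \<Theta> \<longleftrightarrow>
     (\<forall>x. \<Theta> x \<in> space (prob_algebra borel)) \<and>
     (\<forall>B\<in>sets borel. (\<lambda>x. measure (\<Theta> x) B) \<in> borel_measurable borel) \<and>
     (\<forall>A\<in>sets borel. \<forall>B\<in>sets borel.
        measure \<gamma> (A \<times> B) = (LINT x:A|\<eta>. measure (\<Theta> x) B))"

definition kernel_field :: "('e \<Rightarrow> 's measure) \<Rightarrow> 's set set \<Rightarrow> 'e measure" where
  "kernel_field \<Theta> \<C> =
     sigma UNIV {(\<lambda>x. measure (\<Theta> x) C) -` B | C B. C \<in> \<C> \<and> B \<in> sets borel}"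

definition continuity_sets :: "'s::topological_space measure \<Rightarrow> 's measure \<Rightarrow> 's set set" where
  "continuity_sets \<nu> F = {C \<in> sets F. measure \<nu> (frontier C) = 0}"

text \<open>The field \<open>\<G>\<^sub>t(\<gamma>)\<close> of a plan is defined through a chosen kernel;
  \<open>plan_field_eq\<close> below shows that every kernel of \<open>\<gamma>\<close> gives the same sigma-field.\<close>

definition plan_field ::
  "('i \<Rightarrow> 's::topological_space measure) \<Rightarrow> 'e::topological_space measure \<Rightarrow> 's measure \<Rightarrow>
   ('e \<times> 's) measure \<Rightarrow> 'i \<Rightarrow> 'e measure" where
  "plan_field FS \<eta> \<nu> \<gamma> t =
     completed_field \<eta>
       (kernel_field (SOME \<Theta>. plan_kernel \<eta> \<gamma> \<Theta>) (continuity_sets \<nu> (FS t)))"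

definition causal_plans ::
  "'i set \<Rightarrow> ('i \<Rightarrow> 'e::topological_space measure) \<Rightarrow> ('i \<Rightarrow> 's::topological_space measure) \<Rightarrow>
   'e measure \<Rightarrow> 's measure \<Rightarrow> ('e \<times> 's) measure set" where
  "causal_plans I FE FS \<eta> \<nu> =
     {\<gamma> \<in> transference_plans \<eta> \<nu>.
        \<forall>t\<in>I. sets (plan_field FS \<eta> \<nu> \<gamma> t) \<subseteq> sets (completed_field \<eta> (FE t))}"

lemma sets_completed_field:
  assumes "sets G \<subseteq> Pow (space \<mu>)"
  shows "sets (completed_field \<mu> G) =
    sigma_sets (space \<mu>) (sets G \<union> {N. \<exists>N'\<in>null_sets \<mu>. N \<subseteq> N'})"
  unfolding completed_field_def
  using assms sets.sets_into_space[of _ \<mu>]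
  by (intro sets_measure_of) (auto simp: null_sets_def subset_iff)

lemma plan_kernel_AE_unique:
  assumes \<eta>: "\<eta> \<in> space (prob_algebra borel)"
    and \<Theta>: "plan_kernel \<eta> \<gamma> \<Theta>" and \<Theta>': "plan_kernel \<eta> \<gamma> \<Theta>'" and B: "B \<in> sets borel"
  shows "AE x in \<eta>. measure (\<Theta> x) B = measure (\<Theta>' x) B"
proof (rule density_unique_real)
  have [simp]: "sets \<eta> = sets borel" and "prob_space \<eta>"
    using \<eta> by (auto simp: space_prob_algebra)
  then interpret prob_space \<eta> by simp
  have int: "integrable \<eta> (\<lambda>x. measure (K x) B)" if K: "plan_kernel \<eta> \<gamma> K" for K
  proof (rule integrable_const_bound[where B = 1])
    have "prob_space (K x)" for x
      using K by (auto simp: plan_kernel_def space_prob_algebra)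
    then show "AE x in \<eta>. norm (measure (K x) B) \<le> 1"
      by (simp add: prob_space.prob_le_1)
    show "(\<lambda>x. measure (K x) B) \<in> borel_measurable \<eta>"
      using K B by (simp add: plan_kernel_def cong: measurable_cong_sets)
  qed
  show "integrable \<eta> (\<lambda>x. measure (\<Theta> x) B)" "integrable \<eta> (\<lambda>x. measure (\<Theta>' x) B)"
    using int \<Theta> \<Theta>' by auto
  show "(LINT x:A|\<eta>. measure (\<Theta> x) B) = (LINT x:A|\<eta>. measure (\<Theta>' x) B)"
    if "A \<in> sets \<eta>" for A
    using that \<Theta> \<Theta>' B unfolding plan_kernel_def by simp
qed

lemma completed_kernel_field_mono:
  assumes \<eta>: "\<eta> \<in> space (prob_algebra borel)"
    and \<Theta>: "plan_kernel \<eta> \<gamma> \<Theta>" and \<Theta>': "plan_kernel \<eta> \<gamma> \<Theta>'" and \<C>: "\<C> \<subseteq> sets borel"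
  shows "sets (completed_field \<eta> (kernel_field \<Theta> \<C>))
    \<subseteq> sets (completed_field \<eta> (kernel_field \<Theta>' \<C>))"
proof -
  have sp: "space \<eta> = UNIV"
    using \<eta> by (auto simp: space_prob_algebra dest: sets_eq_imp_space_eq)
  let ?gen = "\<lambda>K. {(\<lambda>x. measure (K x) C) -` B | C B. C \<in> \<C> \<and> B \<in> sets borel}"
  let ?M = "completed_field \<eta> (kernel_field \<Theta>' \<C>)"
  have spM: "space ?M = UNIV"
    by (simp add: completed_field_def sp space_measure_of_conv)
  have kf: "sets (kernel_field K \<C>) = sigma_sets UNIV (?gen K)" for K :: "'a \<Rightarrow> 'b measure"
    unfolding kernel_field_def by (rule sets_measure_of) auto
  have null: "N \<in> sets ?M" if "N \<subseteq> N'" "N' \<in> null_sets \<eta>" for N N'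
    using that by (subst sets_completed_field) (auto simp: sp intro!: sigma_sets.Basic)
  have gen: "X \<in> sets ?M" if X: "X \<in> ?gen \<Theta>" for X
  proof -
    obtain C B where C: "C \<in> \<C>" and B: "B \<in> sets borel"
      and X: "X = (\<lambda>x. measure (\<Theta> x) C) -` B" using X by blast
    define Y where "Y = (\<lambda>x. measure (\<Theta>' x) C) -` B"
    have Y: "Y \<in> sets ?M"
      using C B unfolding Y_def
      by (subst sets_completed_field) (auto simp: sp kf intro!: sigma_sets.Basic)
    obtain N where N: "N \<in> null_sets \<eta>" "{x \<in> space \<eta>. measure (\<Theta> x) C \<noteq> measure (\<Theta>' x) C} \<subseteq> N"
      using plan_kernel_AE_unique[OF \<eta> \<Theta> \<Theta>', of C] C \<C> by (auto elim!: AE_E2 AE_E simp: null_sets_def)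
    have "X - Y \<in> sets ?M" "Y - X \<in> sets ?M"
      using N by (auto simp: X Y_def sp intro!: null[of _ N])
    then have "(Y - (Y - X)) \<union> (X - Y) \<in> sets ?M" using Y by blast
    moreover have "(Y - (Y - X)) \<union> (X - Y) = X" by auto
    ultimately show ?thesis by simp
  qed
  have "sets (kernel_field \<Theta> \<C>) \<subseteq> sets ?M"
    unfolding kf using sets.sigma_sets_subset[of "?gen \<Theta>" ?M] gen spM by auto
  then have "sigma_sets (space ?M) (sets (kernel_field \<Theta> \<C>) \<union> {N. \<exists>N'\<in>null_sets \<eta>. N \<subseteq> N'})
      \<subseteq> sets ?M"
    using null by (intro sets.sigma_sets_subset) auto
  then show ?thesis
    by (subst sets_completed_field) (auto simp: sp spM)
qed

lemma plan_field_eq: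
  assumes "\<eta> \<in> space (prob_algebra borel)" "plan_kernel \<eta> \<gamma> \<Theta>" "subalgebra borel (FS t)"
  shows "sets (plan_field FS \<eta> \<nu> \<gamma> t) =
    sets (completed_field \<eta> (kernel_field \<Theta> (continuity_sets \<nu> (FS t))))"
proof -
  have "plan_kernel \<eta> \<gamma> (SOME \<Theta>. plan_kernel \<eta> \<gamma> \<Theta>)"
    using assms(2) by (metis someI)
  moreover have "continuity_sets \<nu> (FS t) \<subseteq> sets borel"
    using assms(3) by (auto simp: continuity_sets_def subalgebra_def)
  ultimately show ?thesis
    unfolding plan_field_def using assms(1,2)
    by (intro equalityI completed_kernel_field_mono) auto
qed

end

theory Submission
  imports Defs
begin

text \<open>The frontiers of the sets \<open>{s. d (\<rho>\<^sub>t s, B) \<le> r}\<close>, for varying \<open>r > 0\<close>, are disjoint, so all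
  but countably many are \<open>\<nu>\<close>-null; hence \<open>\<rho>\<^sub>t\<^sup>-\<^sup>1(B)\<close>, for closed \<open>B\<close>, is a decreasing limit of
  \<open>\<nu>\<close>-continuity sets of the field at time \<open>t\<close>, and a Dynkin argument recovers all of its sets.
  The conditional expectation criterion rests on
  \<open>\<integral>\<^bsub>A \<times> C\<^esub> f \<circ> \<pi> d\<gamma> = \<integral>\<^bsub>A\<^esub> f(x) \<Theta>\<^sup>x(C) d\<eta>(x)\<close>: if \<open>x \<mapsto> \<Theta>\<^sup>x(C)\<close> is measurable for the past of \<open>E\<close>,
  then \<open>f\<close> may be replaced by its conditional expectation in the right-hand side.\<close>

section \<open>Null frontiers among the sublevel sets of a continuous function\<close>

lemma frontier_vimage_atMost:
  fixes g :: "'a::topological_space \<Rightarrow> real"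
  assumes "continuous_on UNIV g"
  shows "frontier (g -` {..r}) \<subseteq> g -` {r}"
proof -
  have "closed (g -` {..r})" "open (g -` {..<r})"
    using assms by (auto intro: closed_vimage open_vimage)
  then have "g -` {..<r} \<subseteq> interior (g -` {..r})" "closure (g -` {..r}) = g -` {..r}"
    using interior_maximal[of "g -` {..<r}" "g -` {..r}"] by fastforce+
  then show ?thesis by (force simp: frontier_def)
qed

text \<open>The mass of the image measure \<open>distr \<nu> borel g\<close> at r is the \<nu>-mass
  of the level set {g = r}, and a finite measure has only countably many points of positive mass.
  Every nonempty open interval therefore contains a level whose level set, and with it the frontier
  of the sublevel set, is \<nu>-null.\<close>

lemma ex_null_frontier_levels:
  fixes g :: "'a::topological_space \<Rightarrow> real"
  assumes g: "continuous_on UNIV g" and \<nu>: "finite_measure \<nu>" and sets: "sets \<nu> = sets borel"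
  obtains r :: "nat \<Rightarrow> real" where "decseq r" "r \<longlonglongrightarrow> 0" "\<And>n. r n > 0"
    "\<And>n. measure \<nu> (frontier (g -` {..r n})) = 0"
proof -
  have gm [measurable]: "g \<in> borel_measurable \<nu>"
    using borel_measurable_continuous_onI[OF g] sets by (simp cong: measurable_cong_sets)
  have sp: "space \<nu> = UNIV" using sets_eq_imp_space_eq[OF sets] by simp
  interpret D: finite_measure "distr \<nu> borel g"
    by (intro finite_measure.finite_measure_distr \<nu> gm)
  \<comment> \<open>Successive intervals share only an endpoint and move towards 0, so any choice of
    one level in each is positive, decreasing and tends to 0.\<close>
  have "\<exists>r. 1 / real (n + 2) < r \<and> r < 1 / real (n + 1) \<and> measure (distr \<nu> borel g) {r} = 0" for n
  proof -
    have "uncountable {1 / real (n + 2)<..<1 / real (n + 1)}"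
      by (subst uncountable_open_interval) (simp add: field_simps)
    then have "\<not> {1 / real (n + 2)<..<1 / real (n + 1)} \<subseteq> {r. measure (distr \<nu> borel g) {r} \<noteq> 0}"
      using D.countable_support countable_subset by blast
    then show ?thesis by auto
  qed
  then obtain r where r: "\<And>n. 1 / real (n + 2) < r n" "\<And>n. r n < 1 / real (n + 1)"
    "\<And>n. measure (distr \<nu> borel g) {r n} = 0" by metis
  have pos: "r n > 0" for n
    by (rule less_trans[OF _ r(1)]) simp
  show ?thesis
  proof
    show "r n > 0" for n by (rule pos)
    show "decseq r"
    proof (rule decseq_SucI)
      fix n
      have "r (Suc n) < 1 / real (n + 2)" using r(2)[of "Suc n"] by simp
      then show "r (Suc n) \<le> r n" using r(1)[of n] by linarith
    qed
    show "r \<longlonglongrightarrow> 0"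
    proof (rule tendsto_sandwich[OF _ _ tendsto_const LIMSEQ_inverse_real_of_nat])
      show "\<forall>\<^sub>F n in sequentially. 0 \<le> r n" using pos by (simp add: less_imp_le)
      show "\<forall>\<^sub>F n in sequentially. r n \<le> inverse (real (Suc n))"
        using r(2) by (simp add: less_imp_le inverse_eq_divide add.commute)
    qed
    show "measure \<nu> (frontier (g -` {..r n})) = 0" for n
    proof -
      have "measure \<nu> (g -` {r n}) = 0"
        using r(3)[of n] by (simp add: measure_distr sp)
      moreover have "measure \<nu> (frontier (g -` {..r n})) \<le> measure \<nu> (g -` {r n})"
        using measurable_sets[OF gm, of "{r n}"] sp
        by (intro finite_measure.finite_measure_mono[OF \<nu>] frontier_vimage_atMost g) auto
      ultimately show ?thesis by (simp add: measure_le_0_iff)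
    qed
  qed
qed

section \<open>Sigma-fields generated by a kernel\<close>

lemma sets_kernel_field:
  "sets (kernel_field \<Theta> \<C>) =
     sigma_sets UNIV {(\<lambda>x. measure (\<Theta> x) C) -` B | C B. C \<in> \<C> \<and> B \<in> sets borel}"
  unfolding kernel_field_def by (rule sets_measure_of) auto

lemma space_kernel_field [simp]: "space (kernel_field \<Theta> \<C>) = UNIV"
  by (simp add: kernel_field_def space_measure_of_conv)

lemma measurable_kernel_field:
  "C \<in> \<C> \<Longrightarrow> (\<lambda>x. measure (\<Theta> x) C) \<in> borel_measurable (kernel_field \<Theta> \<C>)"
  by (intro measurableI) (auto simp: sets_kernel_field)

text \<open>The universal property of a generated sigma-field. It translates every inclusion between
  the fields at stake into measurability of the maps \<open>\<phi>\<^sub>A\<close>.\<close>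

lemma sets_kernel_field_subset_iff:
  assumes "space M = UNIV"
  shows "sets (kernel_field \<Theta> \<C>) \<subseteq> sets M \<longleftrightarrow>
    (\<forall>C\<in>\<C>. (\<lambda>x. measure (\<Theta> x) C) \<in> borel_measurable M)"
proof
  assume "sets (kernel_field \<Theta> \<C>) \<subseteq> sets M"
  then have "(\<lambda>x. x) \<in> measurable M (kernel_field \<Theta> \<C>)"
    using assms by (auto simp: measurable_def)
  then show "\<forall>C\<in>\<C>. (\<lambda>x. measure (\<Theta> x) C) \<in> borel_measurable M"
    by (auto intro: measurable_compose[OF _ measurable_kernel_field])
next
  assume *: "\<forall>C\<in>\<C>. (\<lambda>x. measure (\<Theta> x) C) \<in> borel_measurable M"
  have "sigma_sets (space M) {(\<lambda>x. measure (\<Theta> x) C) -` B | C B. C \<in> \<C> \<and> B \<in> sets borel} \<subseteq> sets M"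
    using * assms by (intro sets.sigma_sets_subset) (use measurable_sets[of _ M borel] in fastforce)
  then show "sets (kernel_field \<Theta> \<C>) \<subseteq> sets M"
    by (simp add: sets_kernel_field assms)
qed

text \<open>The two fields agree exactly, before any completion. Closed sets are reached by limits
  of continuity sets and Borel sets by a Dynkin argument, all pulled back by \<rho>.\<close>

lemma sets_kernel_field_continuity_sets:
  fixes \<nu> :: "'s::polish_space measure"
  assumes \<nu>: "\<nu> \<in> space (prob_algebra borel)"
    and \<Theta>: "\<And>x. \<Theta> x \<in> space (prob_algebra borel)"
    and \<rho>: "continuous_on UNIV (\<rho> :: 's \<Rightarrow> 's)" and F: "sets F = {\<rho> -` B | B. B \<in> sets borel}"
  shows "sets (kernel_field \<Theta> (continuity_sets \<nu> F)) = sets (kernel_field \<Theta> (sets F))"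
proof
  let ?K = "kernel_field \<Theta> (continuity_sets \<nu> F)"
  have "continuity_sets \<nu> F \<subseteq> sets F" by (auto simp: continuity_sets_def)
  then show "sets ?K \<subseteq> sets (kernel_field \<Theta> (sets F))"
    by (subst sets_kernel_field_subset_iff) (auto intro: measurable_kernel_field)
  have prob: "prob_space (\<Theta> x)" and sets_\<Theta>: "sets (\<Theta> x) = sets borel" for x
    using \<Theta>[of x] by (auto simp: space_prob_algebra)
  have sp: "space (\<Theta> x) = UNIV" for x
    using sets_eq_imp_space_eq[OF sets_\<Theta>] by simp
  have \<rho>_sets: "\<rho> -` B \<in> sets (\<Theta> x)" if "B \<in> sets borel" for B x
    using measurable_sets[OF borel_measurable_continuous_onI[OF \<rho>] that] by (simp add: sets_\<Theta>)
  have closed: "(\<lambda>x. measure (\<Theta> x) (\<rho> -` B)) \<in> borel_measurable ?K" if B: "closed B" for B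
  \<comment> \<open>The distance to the empty set is 0 by convention, so \<open>g\<close> below
    would vanish everywhere instead of nowhere; this case is kept apart.\<close>
  proof (cases "B = {}")
    case False
    define g where "g = (\<lambda>s. infdist (\<rho> s) B)"
    have g: "continuous_on UNIV g"
      unfolding g_def by (intro continuous_on_infdist \<rho>)
    have "finite_measure \<nu>" "sets \<nu> = sets borel"
      using \<nu> by (auto simp: space_prob_algebra prob_space.finite_measure)
    from ex_null_frontier_levels[OF g this] obtain r :: "nat \<Rightarrow> real"
      where r: "decseq r" "r \<longlonglongrightarrow> 0" "\<And>n. r n > 0"
        "\<And>n. measure \<nu> (frontier (g -` {..r n})) = 0" by blast
    \<comment> \<open>The sublevel sets of \<open>g\<close> must lie in \<open>F\<close>, not merely
      be Borel; they do because \<open>g\<close> factors through \<rho>.\<close>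
    have vim: "g -` {..r n} = \<rho> -` ((\<lambda>y. infdist y B) -` {..r n})" for n
      by (auto simp: g_def)
    have mem: "(\<lambda>y. infdist y B) -` {..r n} \<in> sets borel" for n
      by (intro borel_closed closed_vimage continuous_on_infdist) auto
    have cont: "g -` {..r n} \<in> continuity_sets \<nu> F" for n
      using r(4) mem by (auto simp: continuity_sets_def F vim)
    have Inter: "(\<Inter>n. g -` {..r n}) = \<rho> -` B"
    proof -
      have "g s \<le> 0" if "\<And>n. g s \<le> r n" for s
        using LIMSEQ_le_const[OF r(2)] that by blast
      moreover have "g s \<ge> 0" for s by (simp add: g_def infdist_nonneg)
      ultimately have "(\<forall>n. g s \<le> r n) \<longleftrightarrow> g s = 0" for s
        using r(3) by (metis dual_order.antisym less_imp_le)
      then show ?thesis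
        using in_closed_iff_infdist_zero[OF B False] by (auto simp: g_def)
    qed
    show ?thesis
    proof (rule borel_measurable_LIMSEQ_real)
      show "(\<lambda>n. measure (\<Theta> x) (g -` {..r n})) \<longlonglongrightarrow> measure (\<Theta> x) (\<rho> -` B)" for x
        unfolding Inter[symmetric]
      proof (rule finite_measure.finite_Lim_measure_decseq)
        show "finite_measure (\<Theta> x)" using prob by (rule prob_space.finite_measure)
        show "range (\<lambda>n. g -` {..r n}) \<subseteq> sets (\<Theta> x)"
          using \<rho>_sets mem by (auto simp: vim)
        show "decseq (\<lambda>n. g -` {..r n})"
          using r(1) by (fastforce simp: decseq_def)
      qed
      show "(\<lambda>x. measure (\<Theta> x) (g -` {..r n})) \<in> borel_measurable ?K" for n
        by (intro measurable_kernel_field cont)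
    qed
  qed simp
  have borel: "(\<lambda>x. measure (\<Theta> x) (\<rho> -` B)) \<in> borel_measurable ?K" if "B \<in> sets borel" for B
  proof -
    \<comment> \<open>Closed sets form an intersection-stable generator. Complements are handled by
      the total mass 1 of \<open>\<Theta> x\<close>, disjoint unions by countable
      additivity.\<close>
    have sb: "sets (borel :: 's measure) = sigma_sets UNIV (Collect closed)"
      by (subst borel_eq_closed) (rule sets_measure_of, auto)
    have "Int_stable (Collect (closed :: 's set \<Rightarrow> bool))" by (auto simp: Int_stable_def)
    moreover have "Collect closed \<subseteq> Pow (UNIV :: 's set)" by simp
    moreover have "B \<in> sigma_sets UNIV (Collect closed)" using that sb by simp
    ultimately show ?thesis
    proof (induction B rule: sigma_sets_induct_disjoint)
      case (compl A)
      then have "\<rho> -` A \<in> sets (\<Theta> x)" for x using \<rho>_sets sb by auto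
      then have "measure (\<Theta> x) (\<rho> -` (UNIV - A)) = 1 - measure (\<Theta> x) (\<rho> -` A)" for x
        using prob_space.prob_compl[OF prob, of "\<rho> -` A" x] by (simp add: sp vimage_Diff)
      then show ?case using compl(2) by simp
    next
      case (union A)
      have "(\<lambda>i. measure (\<Theta> x) (\<rho> -` A i)) sums measure (\<Theta> x) (\<rho> -` (\<Union>i. A i))" for x
        unfolding vimage_UN
      proof (rule finite_measure.finite_measure_UNION)
        show "finite_measure (\<Theta> x)" using prob by (rule prob_space.finite_measure)
        show "range (\<lambda>i. \<rho> -` A i) \<subseteq> sets (\<Theta> x)" using union(2) \<rho>_sets sb by auto
        show "disjoint_family (\<lambda>i. \<rho> -` A i)"
          using union(1) by (auto simp: disjoint_family_on_def)
      qed
      then have "measure (\<Theta> x) (\<rho> -` (\<Union>i. A i)) = (\<Sum>i. measure (\<Theta> x) (\<rho> -` A i))" for x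
        by (rule sums_unique)
      then show ?case using union(3) by simp
    qed (auto intro: closed)
  qed
  show "sets (kernel_field \<Theta> (sets F)) \<subseteq> sets ?K"
    by (subst sets_kernel_field_subset_iff) (auto simp: F intro: borel)
qed

section \<open>Completed sigma-fields and integrals over their sets\<close>

lemma space_completed_field [simp]: "space (completed_field \<mu> G) = space \<mu>"
  by (simp add: completed_field_def space_measure_of_conv)

lemma sets_completed_field_cong:
  "sets G = sets G' \<Longrightarrow> sets (completed_field \<mu> G) = sets (completed_field \<mu> G')"
  by (simp add: completed_field_def)

lemma sets_completed_field_subalgebra:
  assumes "subalgebra \<mu> G"
  shows "sets (completed_field \<mu> G) =
    sigma_sets (space \<mu>) (sets G \<union> {N. \<exists>N'\<in>null_sets \<mu>. N \<subseteq> N'})"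
proof (rule sets_completed_field)
  show "sets G \<subseteq> Pow (space \<mu>)"
    using assms sets.space_closed[of G] by (simp add: subalgebra_def)
qed

lemma null_subset_in_completed_field:
  assumes "subalgebra \<mu> G" "N \<subseteq> N'" "N' \<in> null_sets \<mu>"
  shows "N \<in> sets (completed_field \<mu> G)"
  using assms by (auto simp: sets_completed_field_subalgebra)

lemma sets_subset_completed_field:
  assumes "subalgebra \<mu> G"
  shows "sets G \<subseteq> sets (completed_field \<mu> G)"
  using assms by (auto simp: sets_completed_field_subalgebra)

text \<open>The completed field of \<open>H\<close> already contains all \<mu>-negligible sets, so
  only the sets of \<open>G\<close> have to be tested.\<close>

lemma completed_field_subset_iff:
  assumes "subalgebra \<mu> G" "subalgebra \<mu> H"
  shows "sets (completed_field \<mu> G) \<subseteq> sets (completed_field \<mu> H) \<longleftrightarrow>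
    sets G \<subseteq> sets (completed_field \<mu> H)"
proof
  assume "sets G \<subseteq> sets (completed_field \<mu> H)"
  then have "sigma_sets (space (completed_field \<mu> H)) (sets G \<union> {N. \<exists>N'\<in>null_sets \<mu>. N \<subseteq> N'})
      \<subseteq> sets (completed_field \<mu> H)"
    using null_subset_in_completed_field[OF assms(2)] by (intro sets.sigma_sets_subset) auto
  then show "sets (completed_field \<mu> G) \<subseteq> sets (completed_field \<mu> H)"
    using assms(1) by (simp add: sets_completed_field_subalgebra)
qed (use sets_subset_completed_field[OF assms(1)] in blast)

text \<open>A completed field contains arbitrary subsets of null sets, which \<mu> need not measure.
  Conditional expectations given such a field are therefore formed under
  \<open>completion \<mu>\<close>.\<close>

lemma subalgebra_completed_field:
  assumes "subalgebra \<mu> G"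
  shows "subalgebra (completion \<mu>) (completed_field \<mu> G)"
proof -
  have "sigma_sets (space (completion \<mu>)) (sets G \<union> {N. \<exists>N'\<in>null_sets \<mu>. N \<subseteq> N'})
      \<subseteq> sets (completion \<mu>)"
    using assms
    by (intro sets.sigma_sets_subset) (auto simp: subalgebra_def intro: null_sets_completion)
  then show ?thesis
    using assms sets_completed_field_subalgebra[OF assms] by (simp add: subalgebra_def)
qed

text \<open>A preimage under \<open>f\<close> differs from the one under \<open>g\<close> by subsets
  of a null set, and all of these belong to the completed field.\<close>

lemma borel_measurable_completed_field_AE:
  fixes f g :: "'a \<Rightarrow> real"
  assumes G: "subalgebra \<mu> G" and g: "g \<in> borel_measurable (completed_field \<mu> G)"
    and ae: "AE x in \<mu>. f x = g x"
  shows "f \<in> borel_measurable (completed_field \<mu> G)"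
proof (rule measurableI)
  fix B :: "real set" assume B: "B \<in> sets borel"
  let ?F = "completed_field \<mu> G"
  define X where "X = f -` B \<inter> space ?F"
  define Y where "Y = g -` B \<inter> space ?F"
  obtain N where N: "N \<in> null_sets \<mu>" "{x \<in> space \<mu>. f x \<noteq> g x} \<subseteq> N"
    using ae unfolding eventually_ae_filter by blast
  have "X - Y \<in> sets ?F" "Y - X \<in> sets ?F"
    using N(2) by (auto simp: X_def Y_def intro!: null_subset_in_completed_field[OF G _ N(1)])
  moreover have "Y \<in> sets ?F" unfolding Y_def using g B by (rule measurable_sets)
  ultimately have "(Y - (Y - X)) \<union> (X - Y) \<in> sets ?F" by blast
  moreover have "(Y - (Y - X)) \<union> (X - Y) = X" by auto
  ultimately show "f -` B \<inter> space ?F \<in> sets ?F" by (simp add: X_def)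
qed simp

text \<open>Makes it enough to compare integrals on a generator such as the rectangles. Integrals
  over negligible sets vanish, and adding these sets to \<open>P\<close> keeps it stable under
  intersection, so a Dynkin argument reaches the whole completed field.\<close>

lemma set_integral_eq_completed_field:
  fixes u v :: "'a \<Rightarrow> real"
  assumes \<mu>: "subalgebra \<mu> G" and P: "Int_stable P" "P \<subseteq> Pow (space \<mu>)" "space \<mu> \<in> P"
    and G: "sets G = sigma_sets (space \<mu>) P"
    and u: "integrable (completion \<mu>) u" and v: "integrable (completion \<mu>) v"
    and eq: "\<And>X. X \<in> P \<Longrightarrow> (LINT x:X|completion \<mu>. u x) = (LINT x:X|completion \<mu>. v x)"
    and X: "X \<in> sets (completed_field \<mu> G)"
  shows "(LINT x:X|completion \<mu>. u x) = (LINT x:X|completion \<mu>. v x)"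
proof -
  let ?M = "completion \<mu>"
  let ?N = "{N. \<exists>N'\<in>null_sets \<mu>. N \<subseteq> N'}"
  have PG: "P \<subseteq> sets \<mu>" using \<mu> G by (auto simp: subalgebra_def)
  have N_null: "N \<in> null_sets ?M" if "N \<in> ?N" for N
    using that null_sets_completion_iff2[of N \<mu>] by blast
  have QM: "P \<union> ?N \<subseteq> sets ?M" using PG N_null by auto
  have int: "set_integrable ?M X w" if "integrable ?M w" "X \<in> sets ?M" for X and w :: "'a \<Rightarrow> real"
    using that integrable_mult_indicator[of X ?M w] by (simp add: set_integrable_def)
  have zero: "(LINT x:N|?M. w x) = 0" if "N \<in> ?N" for N and w :: "'a \<Rightarrow> real"
    unfolding set_lebesgue_integral_def
  proof (rule integral_eq_zero_AE)
    show "AE x in ?M. indicator N x *\<^sub>R w x = 0"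
      using AE_not_in[OF N_null[OF that]] by eventually_elim simp
  qed
  have "Int_stable (P \<union> ?N)"
    unfolding Int_stable_def
  proof (intro ballI)
    fix X Y assume X: "X \<in> P \<union> ?N" and Y: "Y \<in> P \<union> ?N"
    show "X \<inter> Y \<in> P \<union> ?N"
    proof (cases "X \<in> P \<and> Y \<in> P")
      case True
      then show ?thesis using P(1) by (simp add: Int_stable_def)
    next
      case False
      then show ?thesis using X Y by blast
    qed
  qed
  moreover have "P \<union> ?N \<subseteq> Pow (space \<mu>)" using QM sets.sets_into_space[of _ ?M] by auto
  moreover have "X \<in> sigma_sets (space \<mu>) (P \<union> ?N)"
  proof -
    have "sigma_sets (space \<mu>) (sets G \<union> ?N) \<subseteq> sigma_sets (space \<mu>) (P \<union> ?N)"
      using sigma_sets_mono'[of P "P \<union> ?N" "space \<mu>"] unfolding G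
      by (intro sigma_sets_mono) auto
    then show ?thesis
      using X \<mu> by (auto simp: sets_completed_field_subalgebra)
  qed
  ultimately show ?thesis
  proof (induction X rule: sigma_sets_induct_disjoint)
    case (basic X)
    from basic show ?case
    proof
      assume "X \<in> P"
      then show ?thesis by (rule eq)
    next
      assume "X \<in> ?N"
      then show ?thesis using zero[of X u] zero[of X v] by simp
    qed
  next
    case empty
    show ?case by (simp add: set_lebesgue_integral_def)
  next
    case (compl A)
    have A: "A \<in> sets ?M" using compl(1) sets.sigma_sets_subset[OF QM] by auto
    have "(LINT x:(A \<union> (space \<mu> - A))|?M. w x) = (LINT x:A|?M. w x) + (LINT x:(space \<mu> - A)|?M. w x)"
      if "integrable ?M w" for w :: "'a \<Rightarrow> real"
      using A that sets.compl_sets[OF A] by (intro set_integral_Un int) auto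
    moreover have "A \<union> (space \<mu> - A) = space \<mu>" using sets.sets_into_space[OF A] by auto
    \<comment> \<open>The integral over the complement is the total integral minus that over
      \<open>A\<close>; the totals agree because \<open>space \<mu>\<close> belongs to
      \<open>P\<close>.\<close>
    ultimately show ?case using compl(2) eq[OF P(3)] u v by (metis add_left_cancel)
  next
    case (union A)
    have A: "A i \<in> sets ?M" for i using union(2) sets.sigma_sets_subset[OF QM] by auto
    have "(LINT x:(\<Union>i. A i)|?M. w x) = (\<Sum>i. LINT x:A i|?M. w x)"
      if "integrable ?M w" for w :: "'a \<Rightarrow> real"
      using union(1) A that
      by (intro lebesgue_integral_countable_add int) (auto simp: disjoint_family_on_def)
    then show ?case using u v union(3) by simp
  qed
qed

lemma finite_measure_completion:
  assumes "finite_measure \<mu>"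
  shows "finite_measure (completion \<mu>)"
  using assms by (intro finite_measureI) (simp add: finite_measure.emeasure_finite)

lemma finite_measure_subalgebra_completed_field:
  assumes "finite_measure \<mu>" "subalgebra \<mu> G"
  shows "finite_measure_subalgebra (completion \<mu>) (completed_field \<mu> G)"
  using finite_measure_completion[OF assms(1)] subalgebra_completed_field[OF assms(2)]
  by (simp add: finite_measure_subalgebra_def finite_measure_subalgebra_axioms_def)

lemma integrable_ess_bounded:
  assumes "finite_measure \<mu>" "f \<in> ess_bounded \<mu>"
  shows "integrable (completion \<mu>) f"
  using assms finite_measure.integrable_const_bound[OF finite_measure_completion, of \<mu> f]
  by (auto simp: ess_bounded_def AE_completion_iff)

section \<open>Disintegration of a plan along its first marginal\<close>

locale disintegrated_plan =
  fixes \<eta> :: "'e::polish_space measure" and \<nu> :: "'s::polish_space measure"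
    and \<gamma> :: "('e \<times> 's) measure" and \<Theta> :: "'e \<Rightarrow> 's measure"
  assumes eta: "\<eta> \<in> space (prob_algebra borel)"
    and plan: "\<gamma> \<in> transference_plans \<eta> \<nu>"
    and kernel: "plan_kernel \<eta> \<gamma> \<Theta>"
begin

lemma sets_eta [simp, measurable_cong]: "sets \<eta> = sets borel"
  and prob_eta: "prob_space \<eta>"
  using eta by (auto simp: space_prob_algebra)

lemma sets_gamma [simp, measurable_cong]: "sets \<gamma> = sets (borel \<Otimes>\<^sub>M borel)"
  and prob_gamma: "prob_space \<gamma>"
  and distr_fst: "distr \<gamma> borel fst = \<eta>"
  using plan by (simp_all only: transference_plans_def space_prob_algebra borel_prod mem_Collect_eq)

lemma space_eta [simp]: "space \<eta> = UNIV" and space_gamma [simp]: "space \<gamma> = UNIV"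
  using sets_eq_imp_space_eq[OF sets_eta] sets_eq_imp_space_eq[OF sets_gamma]
  by (simp_all add: space_pair_measure)

lemma finite_eta: "finite_measure \<eta>" and finite_gamma: "finite_measure \<gamma>"
  using prob_eta prob_gamma by (auto intro: prob_space.finite_measure)

lemma measurable_fst_gamma [measurable]: "fst \<in> measurable \<gamma> \<eta>"
  by measurable

lemma distr_fst_eta: "distr \<gamma> \<eta> fst = \<eta>"
proof -
  have "distr \<gamma> \<eta> fst = distr \<gamma> borel fst" by (intro distr_cong) simp_all
  then show ?thesis by (simp add: distr_fst)
qed

lemma AE_fst: "(AE x in \<eta>. P x) \<Longrightarrow> AE z in \<gamma>. P (fst z)"
  using AE_distrD[OF measurable_fst_gamma, of P] unfolding distr_fst_eta .

text \<open>The preimage of an \<eta>-null set is \<gamma>-null because \<eta> is the first marginal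
  of \<gamma>.\<close>

lemma measurable_fst_completion: "fst \<in> measurable (completion \<gamma>) (completion \<eta>)"
proof (rule completion.measurable_completion2)
  show "null_sets \<eta> \<subseteq> null_sets (distr (completion \<gamma>) \<eta> fst)"
    by (simp add: distr_completion distr_fst_eta)
qed (rule measurable_completion measurable_fst_gamma)+

text \<open>Ensures that a \<open>G\<close>-conditional expectation composed with the projection is
  measurable for the completed product field. A set of \<open>G\<close> pulls back to a rectangle
  with full second side, a negligible set to a negligible set.\<close>

lemma measurable_fst_completed_field:
  assumes G: "subalgebra \<eta> G" and GH: "subalgebra \<gamma> (G \<Otimes>\<^sub>M H)" and H: "space H = UNIV"
  shows "fst \<in> measurable (completed_field \<gamma> (G \<Otimes>\<^sub>M H)) (completed_field \<eta> G)"
proof (rule measurable_sigma_sets)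
  show "sets (completed_field \<eta> G) =
      sigma_sets UNIV (sets G \<union> {N. \<exists>N'\<in>null_sets \<eta>. N \<subseteq> N'})"
    using sets_completed_field_subalgebra[OF G] by simp
  fix A assume "A \<in> sets G \<union> {N. \<exists>N'\<in>null_sets \<eta>. N \<subseteq> N'}"
  then consider "A \<in> sets G" | N where "N \<in> null_sets \<eta>" "A \<subseteq> N" by blast
  then show "fst -` A \<inter> space (completed_field \<gamma> (G \<Otimes>\<^sub>M H)) \<in> sets (completed_field \<gamma> (G \<Otimes>\<^sub>M H))"
  proof cases
    case 1
    have "fst -` A = A \<times> space H" using H by auto
    then have "fst -` A \<in> sets (G \<Otimes>\<^sub>M H)" using 1 by simp
    then show ?thesis using sets_subset_completed_field[OF GH] by auto
  next
    case 2
    have "fst -` N \<in> null_sets \<gamma>"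
      using null_sets_distr_iff[OF measurable_fst_gamma, of N] 2(1) by (simp add: distr_fst_eta)
    then have "fst -` A \<in> sets (completed_field \<gamma> (G \<Otimes>\<^sub>M H))"
      using 2(2) by (intro null_subset_in_completed_field[OF GH]) auto
    then show ?thesis by simp
  qed
qed auto

lemma measurable_kernel [measurable]:
  "C \<in> sets borel \<Longrightarrow> (\<lambda>x. measure (\<Theta> x) C) \<in> borel_measurable \<eta>"
  using kernel by (simp add: plan_kernel_def cong: measurable_cong_sets)

lemma kernel_le_1: "measure (\<Theta> x) C \<le> 1"
  using kernel by (intro prob_space.prob_le_1) (auto simp: plan_kernel_def space_prob_algebra)

lemma integrable_kernel_mult:
  assumes "integrable (completion \<eta>) f" "C \<in> sets borel"
  shows "integrable (completion \<eta>) (\<lambda>x. measure (\<Theta> x) C * f x)"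
proof (rule Bochner_Integration.integrable_bound[OF assms(1)])
  show "AE x in completion \<eta>. norm (measure (\<Theta> x) C * f x) \<le> norm (f x)"
    by (simp add: abs_mult mult_left_le_one_le kernel_le_1)
  show "(\<lambda>x. measure (\<Theta> x) C * f x) \<in> borel_measurable (completion \<eta>)"
    using assms(1) measurable_completion[OF measurable_kernel[OF assms(2)]] by simp
qed

text \<open>The defining identity of the kernel, recast as an equality of measures: \<gamma>
  restricted to E x C projects to the measure with density \<open>\<Theta>\<^sup>x(C)\<close>.
  General integrands then follow from the transfer rules for densities and image measures.\<close>

lemma distr_density_fst:
  assumes C [measurable]: "C \<in> sets borel"
  shows "distr (density \<gamma> (\<lambda>z. ennreal (indicator C (snd z)))) \<eta> fst =
    density \<eta> (\<lambda>x. ennreal (measure (\<Theta> x) C))"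
proof (rule measure_eqI)
  fix A assume "A \<in> sets (distr (density \<gamma> (\<lambda>z. ennreal (indicator C (snd z)))) \<eta> fst)"
  then have A [measurable]: "A \<in> sets borel" by simp
  interpret \<eta>: prob_space \<eta> by (rule prob_eta)
  interpret \<gamma>: prob_space \<gamma> by (rule prob_gamma)
  have "emeasure (distr (density \<gamma> (\<lambda>z. ennreal (indicator C (snd z)))) \<eta> fst) A =
      (\<integral>\<^sup>+ z. ennreal (indicator C (snd z)) * indicator (fst -` A) z \<partial>\<gamma>)"
    using measurable_sets[OF measurable_fst_gamma, of A]
    by (simp add: emeasure_distr emeasure_density)
  also have "\<dots> = (\<integral>\<^sup>+ z. indicator (A \<times> C) z \<partial>\<gamma>)"
    by (intro nn_integral_cong) (auto simp: indicator_def)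
  also have "\<dots> = emeasure \<gamma> (A \<times> C)"
    by (intro nn_integral_indicator) simp
  also have "\<dots> = ennreal (LINT x:A|\<eta>. measure (\<Theta> x) C)"
    using kernel by (simp add: plan_kernel_def \<gamma>.emeasure_eq_measure)
  also have "\<dots> = (\<integral>\<^sup>+ x. ennreal (indicator A x * measure (\<Theta> x) C) \<partial>\<eta>)"
    unfolding set_lebesgue_integral_def
    by (subst nn_integral_eq_integral)
       (auto intro!: \<eta>.integrable_const_bound[where B = 1] simp: indicator_def kernel_le_1)
  also have "\<dots> = emeasure (density \<eta> (\<lambda>x. ennreal (measure (\<Theta> x) C))) A"
    by (subst emeasure_density) (auto intro!: nn_integral_cong simp: indicator_def)
  finally show "emeasure (distr (density \<gamma> (\<lambda>z. ennreal (indicator C (snd z)))) \<eta> fst) A =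
    emeasure (density \<eta> (\<lambda>x. ennreal (measure (\<Theta> x) C))) A" .
qed simp

lemma set_integral_fst:
  fixes f :: "'e \<Rightarrow> real"
  assumes C [measurable]: "C \<in> sets borel" and f: "f \<in> borel_measurable (completion \<eta>)"
  shows "(LINT z:UNIV \<times> C|completion \<gamma>. f (fst z)) = (LINT x|completion \<eta>. measure (\<Theta> x) C * f x)"
proof -
  \<comment> \<open>The transfer rules are applied to \<eta> and \<gamma> themselves, so
    \<open>f\<close> is first exchanged for a Borel version and restored at the end.\<close>
  obtain g where g [measurable]: "g \<in> borel_measurable \<eta>" and fg: "AE x in \<eta>. f x = g x"
    using completion_ex_borel_measurable_real[OF f] by blast
  have UC: "UNIV \<times> C \<in> sets \<gamma>" by simp
  have gg [measurable]: "(\<lambda>z. g (fst z)) \<in> borel_measurable \<gamma>" by measurable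
  have cc [measurable]: "(\<lambda>z. indicator C (snd z) :: real) \<in> borel_measurable \<gamma>" by measurable
  have "(LINT z:UNIV \<times> C|completion \<gamma>. f (fst z)) = (LINT z:UNIV \<times> C|completion \<gamma>. g (fst z))"
    using AE_fst[OF fg] UC
    using measurable_compose[OF measurable_fst_completion f] measurable_completion[OF gg]
    by (intro set_lebesgue_integral_cong_AE) (auto simp: AE_completion_iff elim!: eventually_mono)
  also have "\<dots> = (LINT z|completion \<gamma>. indicator C (snd z) * g (fst z))"
    unfolding set_lebesgue_integral_def
    by (intro Bochner_Integration.integral_cong) (auto simp: indicator_def)
  also have "\<dots> = (LINT z|\<gamma>. indicator C (snd z) * g (fst z))"
    by (intro integral_completion) measurable
  also have "\<dots> = (LINT z|density \<gamma> (\<lambda>z. ennreal (indicator C (snd z))). g (fst z))"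
    by (subst integral_real_density) auto
  also have "\<dots> = (LINT x|density \<eta> (\<lambda>x. ennreal (measure (\<Theta> x) C)). g x)"
    unfolding distr_density_fst[OF C, symmetric] by (subst integral_distr) auto
  also have "\<dots> = (LINT x|\<eta>. measure (\<Theta> x) C * g x)"
    by (subst integral_real_density) auto
  also have "\<dots> = (LINT x|completion \<eta>. measure (\<Theta> x) C * g x)"
    by (intro integral_completion[symmetric]) measurable
  also have "\<dots> = (LINT x|completion \<eta>. measure (\<Theta> x) C * f x)"
    using fg f measurable_completion[OF g] measurable_completion[OF measurable_kernel[OF C]]
    by (intro integral_cong_AE) (auto simp: AE_completion_iff elim!: eventually_mono)
  finally show ?thesis .
qed

lemma integrable_fst:
  fixes f :: "'e \<Rightarrow> real"
  assumes f: "integrable (completion \<eta>) f"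
  shows "integrable (completion \<gamma>) (\<lambda>z. f (fst z))"
proof -
  obtain g where g: "g \<in> borel_measurable \<eta>" and fg: "AE x in \<eta>. f x = g x"
    using completion_ex_borel_measurable_real f by blast
  have "integrable (completion \<eta>) g"
    using f g fg by (subst integrable_cong_AE[of _ _ f])
      (auto simp: AE_completion_iff measurable_completion elim!: eventually_mono)
  then have "integrable (distr \<gamma> \<eta> fst) g"
    using g by (simp add: integrable_completion distr_fst_eta)
  then have "integrable \<gamma> (\<lambda>z. g (fst z))"
    by (rule integrable_distr[OF measurable_fst_gamma])
  then have "integrable (completion \<gamma>) (\<lambda>z. g (fst z))"
    using measurable_compose[OF measurable_fst_gamma g] by (simp add: integrable_completion)
  moreover have "AE z in completion \<gamma>. g (fst z) = f (fst z)"
    using AE_fst[OF fg] by (auto simp: AE_completion_iff elim!: eventually_mono)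
  ultimately show ?thesis
    using measurable_compose[OF measurable_fst_completion, of f borel] f
    by (subst integrable_cong_AE[of _ _ "\<lambda>z. g (fst z)"]) (auto elim!: eventually_mono)
qed

lemma subalgebra_eta: "subalgebra borel G \<Longrightarrow> subalgebra \<eta> G"
  by (simp add: subalgebra_def)

section \<open>Conditional expectations at one fixed time, with past \<open>G\<close> on E and past
  \<open>H\<close> on S\<close>

context
  fixes G :: "'e measure" and H :: "'s measure"
  assumes G: "subalgebra borel G" and H: "subalgebra borel H"
begin

lemma space_past [simp]: "space G = UNIV" "space H = UNIV"
  using G H by (simp_all add: subalgebra_def)

lemma sets_H_borel: "C \<in> sets H \<Longrightarrow> C \<in> sets borel"
  using H by (auto simp: subalgebra_def)

lemma subalgebra_gamma: "subalgebra \<gamma> (G \<Otimes>\<^sub>M H)"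
proof -
  have "sets (G \<Otimes>\<^sub>M H) \<subseteq> sets (borel \<Otimes>\<^sub>M borel)"
    unfolding sets_pair_measure space_past space_borel
    using G H by (intro sigma_sets_mono') (auto simp: subalgebra_def)
  then show ?thesis by (simp add: subalgebra_def space_pair_measure)
qed

interpretation E: finite_measure_subalgebra "completion \<eta>" "completed_field \<eta> G"
  by (intro finite_measure_subalgebra_completed_field finite_eta subalgebra_eta[OF G])

interpretation ES: finite_measure_subalgebra "completion \<gamma>" "completed_field \<gamma> (G \<Otimes>\<^sub>M H)"
  by (intro finite_measure_subalgebra_completed_field finite_gamma subalgebra_gamma)

text \<open>By assumption the indicator of \<open>A\<close> times \<open>\<Theta>\<^sup>x(C)\<close>
  is measurable for the completed \<open>G\<close>, hence an admissible multiplier in the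
  characteristic property of E[f | G]. This settles the rectangles A x C, and they determine the
  conditional expectation.\<close>

lemma cond_exp_if_kernel_measurable:
  assumes \<phi>: "\<And>C. C \<in> sets H \<Longrightarrow> (\<lambda>x. measure (\<Theta> x) C) \<in> borel_measurable (completed_field \<eta> G)"
    and f: "integrable (completion \<eta>) f"
  shows "AE z in \<gamma>. real_cond_exp (completion \<gamma>) (completed_field \<gamma> (G \<Otimes>\<^sub>M H)) (f \<circ> fst) z =
    (real_cond_exp (completion \<eta>) (completed_field \<eta> G) f \<circ> fst) z"
proof -
  define g where "g = real_cond_exp (completion \<eta>) (completed_field \<eta> G) f"
  have g: "integrable (completion \<eta>) g" "g \<in> borel_measurable (completed_field \<eta> G)"
    unfolding g_def using E.real_cond_exp_int(1)[OF f] by auto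
  have rect: "(LINT z:A \<times> C|completion \<gamma>. f (fst z)) = (LINT z:A \<times> C|completion \<gamma>. g (fst z))"
    if A: "A \<in> sets G" and C: "C \<in> sets H" for A C
  proof -
    have A': "A \<in> sets (completed_field \<eta> G)" and A'': "A \<in> sets (completion \<eta>)"
      using A sets_subset_completed_field[OF subalgebra_eta[OF G]] E.subalg by (auto simp: subalgebra_def)
    \<comment> \<open>The indicator of \<open>A\<close> is moved into the integrand, so that the
      formula for UNIV x C applies.\<close>
    have *: "(LINT z:A \<times> C|completion \<gamma>. h (fst z)) =
        (LINT x|completion \<eta>. (indicator A x * measure (\<Theta> x) C) * h x)"
      if h: "integrable (completion \<eta>) h" for h :: "'e \<Rightarrow> real"
    proof -
      have "(LINT z:A \<times> C|completion \<gamma>. h (fst z)) =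
          (LINT z:UNIV \<times> C|completion \<gamma>. indicator A (fst z) * h (fst z))"
        unfolding set_lebesgue_integral_def
        by (intro Bochner_Integration.integral_cong) (auto simp: indicator_def)
      also have "\<dots> = (LINT x|completion \<eta>. measure (\<Theta> x) C * (indicator A x * h x))"
        using h A'' by (intro set_integral_fst sets_H_borel C) auto
      finally show ?thesis by (simp add: mult_ac)
    qed
    have "integrable (completion \<eta>) (\<lambda>x. measure (\<Theta> x) C * (indicator A x * f x))"
      using integrable_mult_indicator[OF A'' f] by (intro integrable_kernel_mult sets_H_borel C) simp
    then have "integrable (completion \<eta>) (\<lambda>x. (indicator A x * measure (\<Theta> x) C) * f x)"
      by (simp add: mult_ac)
    then have "(LINT x|completion \<eta>. (indicator A x * measure (\<Theta> x) C) * g x) =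
        (LINT x|completion \<eta>. (indicator A x * measure (\<Theta> x) C) * f x)"
      unfolding g_def using f A' \<phi>[OF C] by (intro E.real_cond_exp_intg) auto
    then show ?thesis using *[OF f] *[OF g(1)] by simp
  qed
  have "AE z in completion \<gamma>. real_cond_exp (completion \<gamma>) (completed_field \<gamma> (G \<Otimes>\<^sub>M H)) (f \<circ> fst) z =
      g (fst z)"
  proof (rule ES.real_cond_exp_charact)
    show "integrable (completion \<gamma>) (f \<circ> fst)" "integrable (completion \<gamma>) (\<lambda>z. g (fst z))"
      using integrable_fst f g by (auto simp: comp_def)
    show "(\<lambda>z. g (fst z)) \<in> borel_measurable (completed_field \<gamma> (G \<Otimes>\<^sub>M H))"
      by (rule measurable_compose[OF measurable_fst_completed_field g(2)])
         (simp_all add: subalgebra_eta[OF G] subalgebra_gamma)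
    fix X assume X: "X \<in> sets (completed_field \<gamma> (G \<Otimes>\<^sub>M H))"
    let ?P = "{A \<times> C | A C. A \<in> sets G \<and> C \<in> sets H}"
    have "(LINT z:X|completion \<gamma>. f (fst z)) = (LINT z:X|completion \<gamma>. g (fst z))"
    proof (rule set_integral_eq_completed_field[OF subalgebra_gamma, of ?P])
      show "Int_stable ?P" by (rule Int_stable_pair_measure_generator)
      have "UNIV \<in> sets G" "UNIV \<in> sets H"
        using sets.top[of G] sets.top[of H] by simp_all
      then show "space \<gamma> \<in> ?P" by (auto simp: UNIV_Times_UNIV[symmetric] simp del: UNIV_Times_UNIV)
      show "sets (G \<Otimes>\<^sub>M H) = sigma_sets (space \<gamma>) ?P" by (simp add: sets_pair_measure)
      show "(LINT z:X|completion \<gamma>. f (fst z)) = (LINT z:X|completion \<gamma>. g (fst z))" if "X \<in> ?P" for X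
        using that rect by auto
    qed (use X integrable_fst f g in auto)
    then show "(LINT z:X|completion \<gamma>. (f \<circ> fst) z) = (LINT z:X|completion \<gamma>. g (fst z))"
      by (simp add: comp_def)
  qed
  then show ?thesis by (simp add: AE_completion_iff g_def)
qed

text \<open>Testing the identity with \<open>f = \<phi> - E[\<phi> | G\<^sup>\<eta>]\<close>, where \<open>\<phi> x = \<Theta> x C\<close>, on \<open>E \<times> C\<close> gives
  \<open>\<integral> f\<^sup>2 = 0\<close>, because the conditional expectation \<open>E[f | G\<^sup>\<eta>]\<close> vanishes.\<close>

lemma kernel_measurable_if_cond_exp:
  assumes ce: "\<And>f. f \<in> ess_bounded \<eta> \<Longrightarrow>
      AE z in \<gamma>. real_cond_exp (completion \<gamma>) (completed_field \<gamma> (G \<Otimes>\<^sub>M H)) (f \<circ> fst) z =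
        (real_cond_exp (completion \<eta>) (completed_field \<eta> G) f \<circ> fst) z"
    and C: "C \<in> sets H"
  shows "(\<lambda>x. measure (\<Theta> x) C) \<in> borel_measurable (completed_field \<eta> G)"
proof -
  let ?\<phi> = "\<lambda>x. measure (\<Theta> x) C"
  define p where "p = real_cond_exp (completion \<eta>) (completed_field \<eta> G) ?\<phi>"
  define f where "f = (\<lambda>x. ?\<phi> x - p x)"
  define g where "g = real_cond_exp (completion \<eta>) (completed_field \<eta> G) f"
  have \<phi>m: "?\<phi> \<in> borel_measurable (completion \<eta>)"
    using C by (intro measurable_completion measurable_kernel sets_H_borel)
  have \<phi>: "integrable (completion \<eta>) ?\<phi>"
    using \<phi>m kernel_le_1 by (intro E.integrable_const_bound[where B = 1]) auto
  have p: "integrable (completion \<eta>) p" "p \<in> borel_measurable (completed_field \<eta> G)"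
    unfolding p_def using E.real_cond_exp_int(1)[OF \<phi>] by auto
  have f: "integrable (completion \<eta>) f" unfolding f_def using \<phi> p by auto
  \<comment> \<open>Both \<open>?\<phi>\<close> and its conditional expectation take values in [0,1]
    almost everywhere, so their difference \<open>f\<close> is an admissible bounded test
    function.\<close>
  have "AE x in completion \<eta>. p x \<ge> 0" "AE x in completion \<eta>. p x \<le> 1"
    unfolding p_def using kernel_le_1
    by (auto intro!: E.real_cond_exp_ge_c E.real_cond_exp_le_c \<phi>)
  then have f1: "AE x in completion \<eta>. \<bar>f x\<bar> \<le> 1"
  proof eventually_elim
    fix x assume "p x \<ge> 0" "p x \<le> 1"
    then show "\<bar>f x\<bar> \<le> 1"
      using kernel_le_1[of x C] measure_nonneg[of "\<Theta> x" C] unfolding f_def by linarith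
  qed
  then have fe: "f \<in> ess_bounded \<eta>"
    using f by (auto simp: ess_bounded_def AE_completion_iff)
  \<comment> \<open>Since \<open>p\<close> is its own conditional expectation, E[f | G] = p -
    p.\<close>
  have g0: "AE x in completion \<eta>. g x = 0"
    using E.real_cond_exp_diff[OF \<phi> p(1)] E.real_cond_exp_F_meas[OF p]
    unfolding g_def f_def by eventually_elim (simp add: p_def)
  have UC: "UNIV \<times> C \<in> sets (completed_field \<gamma> (G \<Otimes>\<^sub>M H))"
    using C sets.top[of G] sets_subset_completed_field[OF subalgebra_gamma] by auto
  have UCc: "UNIV \<times> C \<in> sets (completion \<gamma>)" using UC ES.subalg by (auto simp: subalgebra_def)
  \<comment> \<open>As E x C lies in the product field, \<open>f \<circ> fst\<close> may be replaced
    there by its conditional expectation, which by \<open>ce\<close> is \<open>g \<circ> fst\<close>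
    and hence null.\<close>
  have "(LINT x|completion \<eta>. ?\<phi> x * f x) = (LINT z:UNIV \<times> C|completion \<gamma>. (f \<circ> fst) z)"
    using f C by (simp add: set_integral_fst sets_H_borel)
  also have "\<dots> = (LINT z:UNIV \<times> C|completion \<gamma>.
      real_cond_exp (completion \<gamma>) (completed_field \<gamma> (G \<Otimes>\<^sub>M H)) (f \<circ> fst) z)"
    using integrable_fst[OF f] UC by (intro ES.real_cond_exp_intA) (auto simp: comp_def)
  also have "\<dots> = (LINT z:UNIV \<times> C|completion \<gamma>. 0)"
  proof (rule set_lebesgue_integral_cong_AE)
    show "AE z \<in> UNIV \<times> C in completion \<gamma>.
        real_cond_exp (completion \<gamma>) (completed_field \<gamma> (G \<Otimes>\<^sub>M H)) (f \<circ> fst) z = 0"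
      using ce[OF fe] AE_fst[of "\<lambda>x. g x = 0"] g0 unfolding AE_completion_iff
      by (auto simp: g_def elim!: eventually_elim2)
  qed (use UCc in auto)
  finally have \<phi>f: "(LINT x|completion \<eta>. ?\<phi> x * f x) = 0" by (simp add: set_lebesgue_integral_def)
  have pf_int: "integrable (completion \<eta>) (\<lambda>x. p x * f x)"
  proof (rule Bochner_Integration.integrable_bound[OF p(1)])
    show "AE x in completion \<eta>. norm (p x * f x) \<le> norm (p x)"
      using f1 by eventually_elim (simp add: abs_mult mult_left_le)
  qed (use p f in auto)
  \<comment> \<open>Orthogonality of \<open>f\<close> to the past: \<open>p\<close> is measurable
    for the completed \<open>G\<close>, so \<open>f\<close> may be replaced by
    \<open>g\<close>.\<close>
  have "(LINT x|completion \<eta>. p x * f x) = (LINT x|completion \<eta>. p x * g x)"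
    unfolding g_def using pf_int p f by (intro E.real_cond_exp_intg(2)[symmetric]) auto
  also have "\<dots> = (LINT x|completion \<eta>. 0)"
    using g0 p f by (intro integral_cong_AE) (auto simp: g_def elim!: eventually_mono)
  finally have pf: "(LINT x|completion \<eta>. p x * f x) = 0" by simp
  have \<phi>f_int: "integrable (completion \<eta>) (\<lambda>x. ?\<phi> x * f x)"
    using C by (intro integrable_kernel_mult f sets_H_borel)
  have sq: "f x * f x = ?\<phi> x * f x - p x * f x" for x by (simp add: f_def algebra_simps)
  have "integrable (completion \<eta>) (\<lambda>x. f x * f x)" "(LINT x|completion \<eta>. f x * f x) = 0"
    unfolding sq using \<phi>f_int pf_int \<phi>f pf by auto
  then have "AE x in completion \<eta>. f x * f x = 0"
    by (subst (asm) integral_nonneg_eq_0_iff_AE) auto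
  then have "AE x in \<eta>. ?\<phi> x = p x"
    unfolding AE_completion_iff by eventually_elim (simp add: f_def)
  then show ?thesis
    by (rule borel_measurable_completed_field_AE[OF subalgebra_eta[OF G] p(2)])
qed

end

end

section \<open>The field of a plan and the characterizations of causality\<close>

theorem lemma4:
  fixes I :: "'i::linorder set"
    and FE :: "'i \<Rightarrow> 'e::polish_space measure"
    and FS :: "'i \<Rightarrow> 's::polish_space measure"
    and \<eta> :: "'e measure" and \<nu> :: "'s measure" and \<gamma> :: "('e \<times> 's) measure"
    and \<Theta> :: "'e \<Rightarrow> 's measure"
  assumes "borel_filtration I FE"
    and "regular_filtration I FS"
    and "\<eta> \<in> space (prob_algebra borel)"
    and "\<nu> \<in> space (prob_algebra borel)"
    and "\<gamma> \<in> transference_plans \<eta> \<nu>"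
    and "plan_kernel \<eta> \<gamma> \<Theta>"
  shows "(\<forall>t\<in>I. sets (plan_field FS \<eta> \<nu> \<gamma> t) =
                 sets (completed_field \<eta> (kernel_field \<Theta> (sets (FS t))))) \<and>
         (\<gamma> \<in> causal_plans I FE FS \<eta> \<nu> \<longleftrightarrow>
            (\<forall>t\<in>I. \<forall>A\<in>sets (FS t).
               (\<lambda>x. measure (\<Theta> x) A) \<in> borel_measurable (completed_field \<eta> (FE t)))) \<and>
         (\<gamma> \<in> causal_plans I FE FS \<eta> \<nu> \<longleftrightarrow>
            (\<forall>f\<in>ess_bounded \<eta>. \<forall>t\<in>I.
               AE z in \<gamma>.
                 real_cond_exp (completion \<gamma>) (completed_field \<gamma> (FE t \<Otimes>\<^sub>M FS t)) (f \<circ> fst) z =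
                 (real_cond_exp (completion \<eta>) (completed_field \<eta> (FE t)) f \<circ> fst) z))"
proof -
  interpret disintegrated_plan \<eta> \<nu> \<gamma> \<Theta>
    using assms(3,5,6) by (rule disintegrated_plan.intro)
  have FE: "subalgebra borel (FE t)" and FS: "subalgebra borel (FS t)" if "t \<in> I" for t
  proof -
    from assms(1) that show "subalgebra borel (FE t)"
      unfolding borel_filtration_def by (elim conjE) (rule bspec)
    from assms(2) have "borel_filtration I FS" unfolding regular_filtration_def by (rule conjunct1)
    with that show "subalgebra borel (FS t)"
      unfolding borel_filtration_def by (elim conjE) (rule bspec)
  qed
  have field: "sets (plan_field FS \<eta> \<nu> \<gamma> t) = sets (completed_field \<eta> (kernel_field \<Theta> (sets (FS t))))"
    if t: "t \<in> I" for t
  proof -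
    obtain \<rho> :: "'i \<Rightarrow> 's \<Rightarrow> 's" where "\<forall>t\<in>I. continuous_on UNIV (\<rho> t)"
      "\<forall>t\<in>I. sets (FS t) = {\<rho> t -` B | B. B \<in> sets borel}"
      using assms(2) unfolding regular_filtration_def by (elim conjE exE) (rule that)
    then have "sets (kernel_field \<Theta> (continuity_sets \<nu> (FS t))) = sets (kernel_field \<Theta> (sets (FS t)))"
      using t kernel unfolding plan_kernel_def
      by (intro sets_kernel_field_continuity_sets[OF assms(4), where \<rho> = "\<rho> t"]) blast+
    \<comment> \<open>\<open>plan_field_eq\<close> passes from the kernel chosen in the definition
      of \<open>plan_field\<close> to the given \<Theta>, after which the two uncompleted fields
      coincide.\<close>
    then show ?thesis
      using plan_field_eq[where FS = FS, OF eta kernel FS[OF t]] sets_completed_field_cong by blast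
  qed
  have kf: "subalgebra \<eta> (kernel_field \<Theta> (sets (FS t)))" if t: "t \<in> I" for t
    using FS[OF t] by (auto simp: subalgebra_def sets_kernel_field_subset_iff)
  have causal: "\<gamma> \<in> causal_plans I FE FS \<eta> \<nu> \<longleftrightarrow> (\<forall>t\<in>I. \<forall>A\<in>sets (FS t).
      (\<lambda>x. measure (\<Theta> x) A) \<in> borel_measurable (completed_field \<eta> (FE t)))"
  proof -
    have "sets (plan_field FS \<eta> \<nu> \<gamma> t) \<subseteq> sets (completed_field \<eta> (FE t)) \<longleftrightarrow>
        (\<forall>A\<in>sets (FS t). (\<lambda>x. measure (\<Theta> x) A) \<in> borel_measurable (completed_field \<eta> (FE t)))"
      if t: "t \<in> I" for t
      \<comment> \<open>Both sides are completed by the same negligible sets, so the inclusion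
        reduces to the generating maps.\<close>
      using completed_field_subset_iff[OF kf[OF t] subalgebra_eta[OF FE[OF t]]]
      by (simp add: field[OF t] sets_kernel_field_subset_iff)
    then show ?thesis using plan by (simp add: causal_plans_def)
  qed
  show ?thesis
  proof (intro conjI)
    show "\<gamma> \<in> causal_plans I FE FS \<eta> \<nu> \<longleftrightarrow> (\<forall>f\<in>ess_bounded \<eta>. \<forall>t\<in>I. AE z in \<gamma>.
        real_cond_exp (completion \<gamma>) (completed_field \<gamma> (FE t \<Otimes>\<^sub>M FS t)) (f \<circ> fst) z =
        (real_cond_exp (completion \<eta>) (completed_field \<eta> (FE t)) f \<circ> fst) z)"
      \<comment> \<open>The kernel criterion (ii) now stands for causality. Essentially bounded
        functions are integrable since \<eta> is finite, which gives one direction; the other tests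
        with bounded functions only.\<close>
      unfolding causal
      using cond_exp_if_kernel_measurable[OF FE FS] kernel_measurable_if_cond_exp[OF FE FS]
        integrable_ess_bounded[OF finite_eta] by blast
  qed (use field causal in auto)
qed

end
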